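(* Let $\mathcal H$ be a Hilbert space and let $\{f_k\}_{k\in\mathbb Z}$ be a frame for $\mathcal H$ that is norm-bounded below. Consider a representation $\{f_k\}_{k\in\mathbb Z}=\bigcup_{j=1}^J\{T_j^n\varphi_j\}_{n\in\mathbb Z}$, where $J\in\mathbb N$, $\varphi_1,\dots,\varphi_J$ are vectors from $\{f_k\}_{k\in\mathbb Z}$, the operators $T_j:\mathcal H\to\mathcal H$ are bounded, and each $\{T_j^n\varphi_j\}_{n\in\mathbb Z}$ is a Riesz sequence. Let $A$ denote a common lower frame bound for the frame $\{f_k\}_{k\in\mathbb Z}$ and all the Riesz sequences $\{T_j^n\varphi_j\}_{n\in\mathbb Z}$, $j=1,\dots,J$. Let $\{g_k\}_{k\in\mathbb Z}$ be a sequence in $\mathcal H$ such that for some $\mu<\sqrt A$, $$\left\|\sum c_k(f_k-g_k)\right\|\le\mu\left(\sum|c_k|^2\right)^{1/2}$$ for all finite scalar sequences $\{c_k\}$. Then there is a finite collection of vectors $\phi_1,\dots,\phi_J$ from $\{g_k\}_{k\in\mathbb Z}$ and corresponding bounded operators $W_j:\mathcal H\to\mathcal H$ such that each $\{W_j^n\phi_j\}_{n\in\mathbb Z}$, $j=1,\dots,J$, is a Riesz sequence, and $$\{g_k\}_{k\in\mathbb Z}=\bigcup_{j=1}^J\{W_j^n\phi_j\}_{n\in\mathbb Z}.$$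
   Context: A sequence $\{f_k\}_{k\in\mathbb Z}$ is a frame for $\mathcal H$ with lower bound $A>0$ if for some $B>0$, $A\|f\|^2\le\sum_{k}|\langle f,f_k\rangle|^2\le B\|f\|^2$ for all $f\in\mathcal H$. It is norm-bounded below if $\inf_k\|f_k\|>0$. A sequence $\{h_n\}_{n\in\mathbb Z}$ is a Riesz sequence if there are $A,B>0$ with $A\sum|c_n|^2\le\|\sum c_nh_n\|^2\le B\sum|c_n|^2$ for all finite scalar sequences; a lower frame bound of a Riesz sequence (as a frame for its closed span) is the same as a lower bound $A$ in this inequality. The unions are unions of indexed families: $\mathbb Z$ is partitioned into $J$ infinite index sets, and the subfamily of $\{f_k\}_{k\in\mathbb Z}$ (respectively $\{g_k\}_{k\in\mathbb Z}$) indexed by the $j$-th set is, after enumeration by $n\in\mathbb Z$, equal to $\{T_j^n\varphi_j\}_{n\in\mathbb Z}$ (respectively $\{W_j^n\phi_j\}_{n\in\mathbb Z}$). An expression $\{T^n\varphi\}_{n\in\mathbb Z}$ for a bounded operator $T$ on $\mathcal H$ means a sequence $\{h_n\}_{n\in\mathbb Z}$ with $h_0=\varphi$, such that $T$ restricts to a bijection of $\operatorname{span}\{h_n\}_{n\in\mathbb Z}$ (finite linear combinations) onto itself and $h_n=T^n\varphi$ for all $n\in\mathbb Z$, with $T^n:=(T^{-1})^{-n}$ for $n<0$, the inverse being taken on this span. *)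

theory Defs
  imports "HOL-Analysis.Analysis"
begin

text \<open>
  The scalar field of a Hilbert space is either the reals or the complex numbers. Both are
  covered by one type class: a real normed field has a multiplicative norm, so it is
  \<open>\<real>\<close> or \<open>\<complex>\<close> up to isometric isomorphism (Gelfand--Mazur), and the
  identity \<open>x * conjg x = \<bar>x\<bar>\<^sup>2\<close> makes \<open>conjg\<close> the usual conjugation.
\<close>

class hilbert_scalar = real_normed_field +
  fixes conjg :: "'a \<Rightarrow> 'a"
  assumes conjg_add: "conjg (x + y) = conjg x + conjg y"
    and mult_conjg: "x * conjg x = ((norm x)\<^sup>2) *\<^sub>R 1"

instantiation real :: hilbert_scalar
begin
definition conjg_real_def: "conjg (x::real) = x"
instance
  by standard (simp_all add: conjg_real_def power2_eq_square)
end

instantiation complex :: hilbert_scalar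
begin
definition conjg_complex_def: "conjg (z::complex) = cnj z"
instance
  by standard (simp_all add: conjg_complex_def scaleR_conv_of_real flip: complex_norm_square)
end

text \<open>
  The inner product is linear in its first argument. Completeness, and the fact that the norm
  is a norm, are part of the class \<open>banach\<close>; \<open>ip_self\<close> says that this norm comes from the
  inner product (and so contains positive definiteness).
\<close>

locale hilbert_space = vector_space smul
  for smul :: "'k::hilbert_scalar \<Rightarrow> 'h::banach \<Rightarrow> 'h" +
  fixes ip :: "'h \<Rightarrow> 'h \<Rightarrow> 'k"
  assumes scale_of_real: "smul (of_real r) x = r *\<^sub>R x"
    and ip_add_left: "ip (x + y) z = ip x z + ip y z"
    and ip_scale_left: "ip (smul a x) y = a * ip x y"
    and ip_conjg: "ip y x = conjg (ip x y)"
    and ip_self: "ip x x = of_real ((norm x)\<^sup>2)"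

lemma hilbert_space_real_inner:
  "hilbert_space (*\<^sub>R) (inner :: 'a::{real_inner, banach} \<Rightarrow> 'a \<Rightarrow> real)"
  by unfold_locales
    (simp_all add: conjg_real_def inner_add_left inner_commute power2_norm_eq_inner algebra_simps)

lemma hilbert_space_complex:
  "hilbert_space (*) (\<lambda>x y :: complex. x * cnj y)"
  by unfold_locales
    (simp_all add: conjg_complex_def scaleR_conv_of_real algebra_simps flip: complex_norm_square)

definition bounded_operator :: "('k::hilbert_scalar \<Rightarrow> 'h::banach \<Rightarrow> 'h) \<Rightarrow> ('h \<Rightarrow> 'h) \<Rightarrow> bool" where
  "bounded_operator smul T \<longleftrightarrow>
     bounded_linear T \<and> (\<forall>a x. T (smul a x) = smul a (T x))"

definition frame_with_lower_bound ::
  "('h::banach \<Rightarrow> 'h \<Rightarrow> 'k::hilbert_scalar) \<Rightarrow> (int \<Rightarrow> 'h) \<Rightarrow> real \<Rightarrow> bool" where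
  "frame_with_lower_bound ip f A \<longleftrightarrow> A > 0 \<and>
     (\<exists>B>0. \<forall>x. (\<lambda>k. (norm (ip x (f k)))\<^sup>2) summable_on UNIV \<and>
        A * (norm x)\<^sup>2 \<le> (\<Sum>\<^sub>\<infinity>k. (norm (ip x (f k)))\<^sup>2) \<and>
        (\<Sum>\<^sub>\<infinity>k. (norm (ip x (f k)))\<^sup>2) \<le> B * (norm x)\<^sup>2)"

definition is_frame ::
  "('h::banach \<Rightarrow> 'h \<Rightarrow> 'k::hilbert_scalar) \<Rightarrow> (int \<Rightarrow> 'h) \<Rightarrow> bool" where
  "is_frame ip f \<longleftrightarrow> (\<exists>A. frame_with_lower_bound ip f A)"

definition norm_bounded_below :: "(int \<Rightarrow> 'h::banach) \<Rightarrow> bool" where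
  "norm_bounded_below f \<longleftrightarrow> (INF k. norm (f k)) > 0"

text \<open>
  A finite scalar sequence is given by a finite index set \<open>F\<close> and coefficients \<open>c\<close>, of which
  only the values on \<open>F\<close> matter.
\<close>

definition riesz_with_lower_bound ::
  "('k::hilbert_scalar \<Rightarrow> 'h::banach \<Rightarrow> 'h) \<Rightarrow> (int \<Rightarrow> 'h) \<Rightarrow> real \<Rightarrow> bool" where
  "riesz_with_lower_bound smul h A \<longleftrightarrow> A > 0 \<and>
     (\<exists>B>0. \<forall>F c. finite F \<longrightarrow>
        A * (\<Sum>n\<in>F. (norm (c n))\<^sup>2) \<le> (norm (\<Sum>n\<in>F. smul (c n) (h n)))\<^sup>2 \<and>
        (norm (\<Sum>n\<in>F. smul (c n) (h n)))\<^sup>2 \<le> B * (\<Sum>n\<in>F. (norm (c n))\<^sup>2))"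

definition riesz_sequence ::
  "('k::hilbert_scalar \<Rightarrow> 'h::banach \<Rightarrow> 'h) \<Rightarrow> (int \<Rightarrow> 'h) \<Rightarrow> bool" where
  "riesz_sequence smul h \<longleftrightarrow> (\<exists>A. riesz_with_lower_bound smul h A)"

text \<open>
  \<open>operator_orbit smul T v h\<close> says that \<open>h\<close> is a sequence denoted by
  \<open>{T\<^sup>n v}\<close>, \<open>n \<in> \<int>\<close>. The operator \<open>T\<close> need not be invertible on the whole
  space, so negative powers use its inverse on the span of \<open>h\<close>; therefore \<open>h\<close> is a
  parameter of the notion and not a function of \<open>T\<close> and \<open>v\<close>.
\<close>

definition operator_orbit ::
  "('k::hilbert_scalar \<Rightarrow> 'h::banach \<Rightarrow> 'h) \<Rightarrow> ('h \<Rightarrow> 'h) \<Rightarrow> 'h \<Rightarrow> (int \<Rightarrow> 'h) \<Rightarrow> bool" where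
  "operator_orbit smul T v h \<longleftrightarrow>
     (let S = module.span smul (range h) in
        h 0 = v \<and> bij_betw T S S \<and>
        (\<forall>n. h n = (if n \<ge> 0 then (T ^^ nat n) v else (the_inv_into S T ^^ nat (- n)) v)))"

text \<open>
  \<open>f\<close> is the union of the families \<open>h 1, \<dots>, h J\<close> as indexed families: the index set \<open>\<int>\<close> is
  partitioned into sets \<open>I 1, \<dots>, I J\<close>, each enumerated bijectively by \<open>\<int>\<close> through \<open>e j\<close>
  (so each is infinite), and \<open>h j\<close> is the subfamily of \<open>f\<close> over \<open>I j\<close> in that enumeration.
\<close>

definition indexed_union :: "nat \<Rightarrow> (nat \<Rightarrow> int \<Rightarrow> 'h) \<Rightarrow> (int \<Rightarrow> 'h) \<Rightarrow> bool" where
  "indexed_union J h f \<longleftrightarrow>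
     (\<exists>I e. disjoint_family_on I {1..J} \<and> (\<Union>j\<in>{1..J}. I j) = UNIV \<and>
        (\<forall>j\<in>{1..J}. bij_betw (e j) UNIV (I j) \<and> (\<forall>n. h j n = f (e j n))))"

end

theory Submission
  imports Defs
begin

text \<open>
  On each orbit the perturbation has size at most \<open>\<mu> < sqrt A\<close> relative to the \<open>\<ell>\<^sup>2\<close> norm of the
  coefficients, so the perturbed family is again a Riesz sequence. The right shift along a Riesz
  sequence is bounded on its span; extending it to the closed span by continuity and to the whole
  space by the orthogonal projection gives \<open>W\<^sub>j\<close>.
\<close>

section \<open>Conjugation on the scalar field\<close>

lemma conjg_0 [simp]: "conjg (0::'k::hilbert_scalar) = 0"
  using conjg_add[of "0::'k" 0] by simp

lemma mult_conjg_of_real: "x * conjg x = of_real ((norm (x::'k::hilbert_scalar))\<^sup>2)"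
  by (simp add: mult_conjg of_real_def)

text \<open>The axioms give \<open>conjg\<close> only through additivity and the product
  \<open>x * conjg x\<close>, so its value at a nonzero scalar is found by cancelling that
  scalar.\<close>

lemma conjg_of_real [simp]: "conjg (of_real r :: 'k::hilbert_scalar) = of_real r"
proof (cases "r = 0")
  case False
  have "(of_real r :: 'k) * conjg (of_real r) = of_real r * of_real r"
    by (simp add: mult_conjg_of_real power2_eq_square)
  with False show ?thesis by simp
qed simp

text \<open>Multiplicativity of the norm gives both sides the same product with
  \<open>a * b\<close>, which cancels when nonzero.\<close>

lemma conjg_mult: "conjg (a * b :: 'k::hilbert_scalar) = conjg a * conjg b"
proof (cases "a * b = 0")
  case False
  have "(a * b) * conjg (a * b) = (a * conjg a) * (b * conjg b)"
    by (simp add: mult_conjg_of_real norm_mult power_mult_distrib)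
  also have "\<dots> = (a * b) * (conjg a * conjg b)" by (simp add: mult_ac)
  finally show ?thesis using False by simp
qed auto

section \<open>Inner product, norm and scalar multiplication\<close>

context hilbert_space
begin

lemma ip_add_right: "ip x (y + z) = ip x y + ip x z"
  by (metis ip_add_left ip_conjg conjg_add)

lemma ip_scale_right: "ip x (smul a y) = conjg a * ip x y"
  by (metis ip_scale_left ip_conjg conjg_mult)

lemma ip_minus_left: "ip (- x) y = - ip x y"
  using ip_scale_left[of "-1" x y] by simp

lemma ip_minus_right: "ip x (- y) = - ip x y"
  by (metis add.right_inverse add_eq_0_iff ip_add_right add_cancel_right_right)

lemma ip_diff_left: "ip (x - y) z = ip x z - ip y z"
  using ip_add_left[of x "- y" z] by (simp add: ip_minus_left)

lemma ip_diff_right: "ip x (y - z) = ip x y - ip x z"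
  using ip_add_right[of x y "- z"] by (simp add: ip_minus_right)

text \<open>The class \<open>banach\<close> makes the norm homogeneous for real scalars only; for
  the scalars of \<open>smul\<close> this comes from the inner product.\<close>

lemma norm_smul: "norm (smul a x) = norm a * norm x"
proof -
  have "of_real ((norm (smul a x))\<^sup>2) = ip (smul a x) (smul a x)"
    by (rule ip_self[symmetric])
  also have "\<dots> = (a * conjg a) * ip x x"
    by (simp only: ip_scale_left ip_scale_right mult_ac)
  also have "\<dots> = (of_real ((norm a * norm x)\<^sup>2) :: 'k)"
    by (simp add: mult_conjg_of_real ip_self power_mult_distrib)
  finally have "(norm (smul a x))\<^sup>2 = (norm a * norm x)\<^sup>2" by (simp only: of_real_eq_iff)
  thus ?thesis by (simp add: power2_eq_iff_nonneg)
qed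

lemma bounded_linear_smul: "bounded_linear (smul a)"
proof (rule bounded_linear_intro)
  show "smul a (r *\<^sub>R x) = r *\<^sub>R smul a x" for r x
    by (simp add: scale_of_real[symmetric] mult.commute)
  show "norm (smul a x) \<le> norm x * norm a" for x
    by (simp add: norm_smul mult.commute)
qed (simp add: scale_right_distrib)

lemma parallelogram:
  fixes x y :: 'h
  shows "(norm (x + y))\<^sup>2 + (norm (x - y))\<^sup>2 = 2 * (norm x)\<^sup>2 + 2 * (norm y)\<^sup>2"
proof -
  have "of_real ((norm (x + y))\<^sup>2 + (norm (x - y))\<^sup>2) = ip (x + y) (x + y) + ip (x - y) (x - y)"
    by (simp add: ip_self)
  also have "\<dots> = 2 * ip x x + 2 * ip y y"
    by (simp add: ip_add_left ip_add_right ip_diff_left ip_diff_right)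
  also have "\<dots> = (of_real (2 * (norm x)\<^sup>2 + 2 * (norm y)\<^sup>2) :: 'k)"
    by (simp add: ip_self)
  finally show ?thesis by (simp only: of_real_eq_iff)
qed

section \<open>Closed subspaces and orthogonal projection\<close>

lemma subspace_closure:
  assumes "subspace S"
  shows "subspace (closure S)"
proof (rule subspaceI)
  show "0 \<in> closure S" using assms closure_subset subspace_0 by blast
next
  fix x y assume "x \<in> closure S" "y \<in> closure S"
  then obtain a b where "\<forall>n. a n \<in> S" "a \<longlonglongrightarrow> x" "\<forall>n. b n \<in> S" "b \<longlonglongrightarrow> y"
    unfolding closure_sequential by blast
  then show "x + y \<in> closure S"
    unfolding closure_sequential
    by (intro exI[of _ "\<lambda>n. a n + b n"]) (auto intro: tendsto_add subspace_add[OF assms])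
next
  fix c x assume "x \<in> closure S"
  then obtain a where "\<forall>n. a n \<in> S" "a \<longlonglongrightarrow> x"
    unfolding closure_sequential by blast
  then show "smul c x \<in> closure S"
    unfolding closure_sequential
    by (intro exI[of _ "\<lambda>n. smul c (a n)"])
      (auto intro: bounded_linear.tendsto[OF bounded_linear_smul] subspace_scale[OF assms])
qed

text \<open>A minimising sequence is Cauchy: by the parallelogram law, two nearly closest points far
  apart would have a midpoint in \<open>M\<close> closer to \<open>x\<close> than the infimum
  allows. Completeness and closedness then give a limit in \<open>M\<close>.\<close>

lemma closest_point_exists:
  assumes M: "subspace M" "closed M"
  obtains p where "p \<in> M" "\<And>m. m \<in> M \<Longrightarrow> norm (x - p) \<le> norm (x - m)"
proof -
  define D where "D = (\<lambda>m. (norm (x - m))\<^sup>2) ` M"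
  define d where "d = Inf D"
  have ne: "D \<noteq> {}" using subspace_0[OF M(1)] by (auto simp: D_def)
  have bdd: "bdd_below D" by (rule bdd_belowI[of _ 0]) (auto simp: D_def)
  have dle: "d \<le> (norm (x - m))\<^sup>2" if "m \<in> M" for m
    unfolding d_def using bdd that by (intro cInf_lower) (auto simp: D_def)
  have "\<exists>m\<in>M. (norm (x - m))\<^sup>2 < d + inverse (real (Suc n))" for n
  proof -
    have "Inf D < d + inverse (real (Suc n))" by (simp add: d_def)
    from cInf_lessD[OF ne this] show ?thesis by (auto simp: D_def)
  qed
  then obtain s where s: "\<And>n. s n \<in> M" "\<And>n. (norm (x - s n))\<^sup>2 < d + inverse (real (Suc n))"
    by metis
  have est: "(norm (s i - s j))\<^sup>2 \<le> 2 * inverse (real (Suc i)) + 2 * inverse (real (Suc j))" for i j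
  proof -
    define q where "q = (1/2) *\<^sub>R (s i + s j)"
    have q: "q \<in> M"
      unfolding q_def scale_of_real[symmetric]
      by (intro subspace_scale subspace_add M s)
    have "(x - s i) + (x - s j) = 2 *\<^sub>R (x - q)"
      by (simp add: q_def scaleR_right_diff_distrib scaleR_2)
    hence a: "(norm ((x - s i) + (x - s j)))\<^sup>2 = 4 * (norm (x - q))\<^sup>2"
      by (simp add: power_mult_distrib)
    have b: "(norm ((x - s i) - (x - s j)))\<^sup>2 = (norm (s i - s j))\<^sup>2"
      by (simp add: norm_minus_commute)
    show ?thesis
      using parallelogram[of "x - s i" "x - s j"] dle[OF q] s(2)[of i] s(2)[of j]
      unfolding a b by linarith
  qed
  have "Cauchy s"
  proof (rule metric_CauchyI)
    fix e :: real assume e: "e > 0"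
    \<comment> \<open>For indices from \<open>N\<close> on, the bound in \<open>est\<close> is at
      most 4 / (N + 1), hence the quarter of \<open>e\<^sup>2\<close>.\<close>
    then obtain N where N: "inverse (real (Suc N)) < e\<^sup>2 / 4"
      using reals_Archimedean[of "e\<^sup>2 / 4"] by auto
    have "dist (s i) (s j) < e" if "i \<ge> N" "j \<ge> N" for i j
    proof -
      have "inverse (real (Suc i)) \<le> inverse (real (Suc N))"
        "inverse (real (Suc j)) \<le> inverse (real (Suc N))"
        using that by (auto intro!: le_imp_inverse_le)
      hence "(norm (s i - s j))\<^sup>2 < e\<^sup>2" using est[of i j] N by linarith
      thus ?thesis using e by (simp add: dist_norm power2_less_imp_less)
    qed
    thus "\<exists>N. \<forall>i\<ge>N. \<forall>j\<ge>N. dist (s i) (s j) < e" by blast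
  qed
  then obtain p where p: "s \<longlonglongrightarrow> p" using Cauchy_convergent_iff convergent_def by blast
  show ?thesis
  proof
    show "p \<in> M" using closed_sequentially[OF M(2)] s(1) p by blast
    fix m assume m: "m \<in> M"
    have l1: "(\<lambda>n. (norm (x - s n))\<^sup>2) \<longlonglongrightarrow> (norm (x - p))\<^sup>2"
      by (intro tendsto_intros p)
    have l2: "(\<lambda>n. d + inverse (real (Suc n))) \<longlonglongrightarrow> d + 0"
      by (intro tendsto_intros LIMSEQ_inverse_real_of_nat)
    have "(norm (x - p))\<^sup>2 \<le> d + 0"
      by (rule LIMSEQ_le[OF l1 l2]) (use s(2) less_imp_le in blast)
    with dle[OF m] have "(norm (x - p))\<^sup>2 \<le> (norm (x - m))\<^sup>2" by linarith
    thus "norm (x - p) \<le> norm (x - m)" by (rule power2_le_imp_le) simp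
  qed
qed

text \<open>Otherwise a small step from \<open>p\<close> inside \<open>M\<close> would come closer
  to \<open>x\<close>: the gain is linear in the step length, the loss quadratic.\<close>

lemma closest_point_orthogonal:
  assumes M: "subspace M" and p: "p \<in> M" "\<And>m. m \<in> M \<Longrightarrow> norm (x - p) \<le> norm (x - m)"
    and m: "m \<in> M"
  shows "ip (x - p) m = 0"
proof (rule ccontr)
  define y where "y = x - p"
  define c where "c = ip y m"
  assume "ip (x - p) m \<noteq> 0"
  hence c: "norm c > 0" by (simp add: c_def y_def)
  have ge: "0 \<le> (norm c)\<^sup>2 * (t\<^sup>2 * (norm m)\<^sup>2 - 2 * t)" for t :: real
  proof -
    \<comment> \<open>The factor \<open>c\<close> fixes the phase: both mixed terms become
      \<open>t\<close> times the squared norm of \<open>c\<close>, and the expansion is a real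
      quadratic in \<open>t\<close>.\<close>
    define a where "a = of_real t * c"
    have my: "ip m y = conjg c" unfolding c_def by (rule ip_conjg)
    have "of_real ((norm (y - smul a m))\<^sup>2) = ip (y - smul a m) (y - smul a m)"
      by (rule ip_self[symmetric])
    also have "\<dots> =
        ip y y - conjg a * c - a * conjg c + (a * conjg a) * ip m m"
      by (simp add: ip_diff_left ip_diff_right ip_scale_left ip_scale_right
        my c_def[symmetric] algebra_simps)
    also have "\<dots> = ip y y - of_real (2 * t) * (c * conjg c) + of_real (t\<^sup>2) * (c * conjg c) * ip m m"
      by (simp add: a_def conjg_mult algebra_simps power2_eq_square)
    also have "\<dots> = of_real ((norm y)\<^sup>2 - (2 * t) * (norm c)\<^sup>2 + t\<^sup>2 * (norm c)\<^sup>2 * (norm m)\<^sup>2)"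
      by (simp only: mult_conjg_of_real ip_self of_real_mult of_real_add of_real_diff)
    finally have e: "(norm (y - smul a m))\<^sup>2 =
        (norm y)\<^sup>2 - (2 * t) * (norm c)\<^sup>2 + t\<^sup>2 * (norm c)\<^sup>2 * (norm m)\<^sup>2"
      by (simp only: of_real_eq_iff)
    have "norm y \<le> norm (y - smul a m)"
      using p(2)[of "p + smul a m"] subspace_add[OF M p(1) subspace_scale[OF M m]]
      by (simp add: y_def algebra_simps)
    hence "(norm y)\<^sup>2 \<le> (norm (y - smul a m))\<^sup>2" by (simp add: power_mono)
    thus ?thesis unfolding e by (simp add: algebra_simps)
  qed
  \<comment> \<open>The summand 1 keeps the denominator positive even for \<open>m = 0\<close> and
    makes \<open>t * (norm m)\<^sup>2\<close> smaller than 1.\<close>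
  define t where "t = inverse ((norm m)\<^sup>2 + 1)"
  have t: "t > 0" by (simp add: t_def add_nonneg_pos)
  have "t * (norm m)\<^sup>2 < 1"
    unfolding t_def by (simp add: divide_simps add_nonneg_pos add_nonneg_eq_0_iff)
  hence "t * (t * (norm m)\<^sup>2 - 2) < 0" using t by (intro mult_pos_neg) auto
  hence "(norm c)\<^sup>2 * (t\<^sup>2 * (norm m)\<^sup>2 - 2 * t) < 0"
    using c by (intro mult_pos_neg) (auto simp: power2_eq_square algebra_simps)
  with ge[of t] show False by simp
qed

text \<open>\<open>P\<close> is the closest point map. Orthogonality of \<open>x - P x\<close> to
  \<open>M\<close> determines \<open>P x\<close>, so linearity of \<open>P\<close> follows from
  linearity of \<open>ip\<close> in its first argument.\<close>

lemma bounded_projection_exists: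
  assumes M: "subspace M" "closed M"
  obtains P where "bounded_operator smul P" "\<And>x. P x \<in> M" "\<And>x. x \<in> M \<Longrightarrow> P x = x"
proof -
  have "\<exists>p. p \<in> M \<and> (\<forall>m\<in>M. norm (x - p) \<le> norm (x - m))" for x
    using closest_point_exists[OF M] by metis
  then obtain P where P: "\<And>x. P x \<in> M" "\<And>x m. m \<in> M \<Longrightarrow> norm (x - P x) \<le> norm (x - m)"
    by metis
  have orth: "ip (x - P x) m = 0" if "m \<in> M" for x m
    using closest_point_orthogonal[OF M(1) P that] .
  \<comment> \<open>The difference of two such points lies in \<open>M\<close> and is orthogonal to
    \<open>M\<close>, hence to itself.\<close>
  have uniq: "P x = p" if "p \<in> M" "\<And>m. m \<in> M \<Longrightarrow> ip (x - p) m = 0" for x p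
  proof -
    have m: "P x - p \<in> M" using subspace_diff[OF M(1) P(1) that(1)] .
    have "ip (P x - p) (P x - p) = ip (x - p) (P x - p) - ip (x - P x) (P x - p)"
      by (simp add: ip_diff_left)
    also have "\<dots> = 0" using orth[OF m] that(2)[OF m] by simp
    finally show ?thesis by (simp add: ip_self)
  qed
  have add: "P (x + y) = P x + P y" for x y
  proof (rule uniq)
    show "P x + P y \<in> M" by (intro subspace_add M P)
    fix m assume "m \<in> M"
    thus "ip (x + y - (P x + P y)) m = 0"
      using orth[of m x] orth[of m y] by (simp add: ip_diff_left ip_add_left)
  qed
  have scale: "P (smul a x) = smul a (P x)" for a x
  proof (rule uniq)
    show "smul a (P x) \<in> M" by (intro subspace_scale M P)
    fix m assume "m \<in> M"
    thus "ip (smul a x - smul a (P x)) m = 0"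
      using orth[of m x] by (simp add: scale_right_diff_distrib[symmetric] ip_scale_left)
  qed
  have "bounded_linear P"
  proof (rule bounded_linear_intro[where K = 2])
    show "P (r *\<^sub>R x) = r *\<^sub>R P x" for r x using scale[of "of_real r"] by (simp add: scale_of_real)
    \<comment> \<open>Comparison with the point 0 of \<open>M\<close> bounds
      \<open>norm (x - P x)\<close> by \<open>norm x\<close>; the triangle inequality gives the
      factor 2.\<close>
    show "norm (P x) \<le> norm x * 2" for x
      using P(2)[OF subspace_0[OF M(1)], of x] norm_triangle_ineq4[of x "x - P x"] by simp
  qed (rule add)
  moreover have "P x = x" if "x \<in> M" for x using P(2)[OF that, of x] by simp
  ultimately show ?thesis using that P(1) scale by (auto simp: bounded_operator_def)
qed

section \<open>Extension of bounded maps from a subspace\<close>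

text \<open>Boundedness makes \<open>G\<close> uniformly continuous on \<open>S\<close>, so
  completeness yields an extension to \<open>closure S\<close>. Composing it with the projection
  onto \<open>closure S\<close> defines the operator everywhere.\<close>

lemma bounded_operator_extension:
  assumes S: "subspace S"
    and add: "\<And>x y. x \<in> S \<Longrightarrow> y \<in> S \<Longrightarrow> G (x + y) = G x + G y"
    and scale: "\<And>a x. x \<in> S \<Longrightarrow> G (smul a x) = smul a (G x)"
    and bound: "\<And>x. x \<in> S \<Longrightarrow> norm (G x) \<le> K * norm x"
  obtains W where "bounded_operator smul W" "\<And>x. x \<in> S \<Longrightarrow> W x = G x"
proof -
  \<comment> \<open>The maximum with 1 ensures a positive constant, so that \<open>e / K'\<close>
    can serve as the radius for uniform continuity.\<close>
  define K' where "K' = max K 1"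
  have K': "K' > 0" by (simp add: K'_def)
  have bound': "norm (G x) \<le> K' * norm x" if "x \<in> S" for x
    using bound[OF that] mult_right_mono[of K K' "norm x"] by (simp add: K'_def)
  have diff: "G x - G y = G (x - y)" if "x \<in> S" "y \<in> S" for x y
    using add[of "x - y" y] subspace_diff[OF S] that by simp
  have "uniformly_continuous_on S G"
    unfolding uniformly_continuous_on_def
  proof (intro allI impI)
    fix e :: real assume e: "e > 0"
    have "dist (G y) (G x) < e" if "x \<in> S" "y \<in> S" "dist y x < e / K'" for x y
    proof -
      have "dist (G y) (G x) \<le> K' * dist y x"
        using bound'[of "y - x"] diff[of y x] subspace_diff[OF S] that by (simp add: dist_norm)
      also have "\<dots> < e" using that(3) K' by (simp add: field_simps)
      finally show ?thesis .
    qed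
    thus "\<exists>d>0. \<forall>x\<in>S. \<forall>x'\<in>S. dist x' x < d \<longrightarrow> dist (G x') (G x) < e"
      using e K' by (intro exI[of _ "e / K'"]) auto
  qed
  then obtain E where E: "uniformly_continuous_on (closure S) E" "\<And>x. x \<in> S \<Longrightarrow> G x = E x"
    using uniformly_continuous_on_extension_on_closure by metis
  \<comment> \<open>Along sequences in \<open>S\<close> the values of \<open>G\<close> converge to
    those of \<open>E\<close>; additivity, homogeneity and the bound pass to \<open>E\<close> as
    limits.\<close>
  have lim: "(\<lambda>n. G (a n)) \<longlonglongrightarrow> E x" if "\<And>n. a n \<in> S" "a \<longlonglongrightarrow> x" for a x
  proof -
    have "x \<in> closure S" using that closure_sequential by blast
    hence "(\<lambda>n. E (a n)) \<longlonglongrightarrow> E x"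
      by (intro continuous_on_tendsto_compose[OF uniformly_continuous_imp_continuous[OF E(1)] that(2)])
        (use that(1) closure_subset in \<open>auto intro!: always_eventually\<close>)
    thus ?thesis using E(2) that(1) by simp
  qed
  note clS = subspace_closure[OF S]
  have Eadd: "E (x + y) = E x + E y" if xy: "x \<in> closure S" "y \<in> closure S" for x y
  proof -
    obtain a b where ab: "\<And>n. a n \<in> S" "a \<longlonglongrightarrow> x" "\<And>n. b n \<in> S" "b \<longlonglongrightarrow> y"
      using xy unfolding closure_sequential by blast
    have "(\<lambda>n. G (a n + b n)) \<longlonglongrightarrow> E (x + y)"
      by (intro lim tendsto_add ab subspace_add[OF S])
    moreover have "(\<lambda>n. G (a n + b n)) \<longlonglongrightarrow> E x + E y"
      using tendsto_add[OF lim[OF ab(1,2)] lim[OF ab(3,4)]] by (simp add: add ab)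
    ultimately show ?thesis by (rule LIMSEQ_unique)
  qed
  have Escale: "E (smul c x) = smul c (E x)" if x: "x \<in> closure S" for c x
  proof -
    obtain a where a: "\<And>n. a n \<in> S" "a \<longlonglongrightarrow> x"
      using x unfolding closure_sequential by blast
    have "(\<lambda>n. G (smul c (a n))) \<longlonglongrightarrow> E (smul c x)"
      by (intro lim bounded_linear.tendsto[OF bounded_linear_smul] a subspace_scale[OF S])
    moreover have "(\<lambda>n. G (smul c (a n))) \<longlonglongrightarrow> smul c (E x)"
      using bounded_linear.tendsto[OF bounded_linear_smul lim[OF a]] by (simp add: scale a)
    ultimately show ?thesis by (rule LIMSEQ_unique)
  qed
  have Ebound: "norm (E x) \<le> K' * norm x" if x: "x \<in> closure S" for x
  proof -
    obtain a where a: "\<And>n. a n \<in> S" "a \<longlonglongrightarrow> x"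
      using x unfolding closure_sequential by blast
    show ?thesis
      by (rule LIMSEQ_le[OF tendsto_norm[OF lim[OF a]]
            tendsto_mult[OF tendsto_const[of K'] tendsto_norm[OF a(2)]]])
        (use bound' a(1) in blast)
  qed
  obtain P where P: "bounded_operator smul P" "\<And>x. P x \<in> closure S"
      "\<And>x. x \<in> closure S \<Longrightarrow> P x = x"
    using bounded_projection_exists[OF clS closed_closure] by metis
  have Plin: "bounded_linear P" "\<And>a x. P (smul a x) = smul a (P x)"
    using P(1) by (auto simp: bounded_operator_def)
  obtain C where C: "\<And>x. norm (P x) \<le> norm x * C"
    using bounded_linear.bounded[OF Plin(1)] by blast
  have Wscale: "E (P (smul a x)) = smul a (E (P x))" for a x
    by (simp add: Plin(2) Escale P(2))
  have "bounded_linear (\<lambda>x. E (P x))"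
  proof (rule bounded_linear_intro[where K = "C * K'"])
    show "E (P (x + y)) = E (P x) + E (P y)" for x y
      by (simp add: linear_add[OF bounded_linear.linear[OF Plin(1)]] Eadd P(2))
    show "E (P (r *\<^sub>R x)) = r *\<^sub>R E (P x)" for r x
      using Wscale[of "of_real r" x] by (simp add: scale_of_real)
    show "norm (E (P x)) \<le> norm x * (C * K')" for x
    proof -
      have "norm (E (P x)) \<le> K' * norm (P x)" by (rule Ebound[OF P(2)])
      also have "\<dots> \<le> K' * (norm x * C)" using K' C by (intro mult_left_mono) auto
      finally show ?thesis by (simp add: mult_ac)
    qed
  qed
  moreover have "E (P x) = G x" if "x \<in> S" for x
    using that P(3)[of x] closure_subset[of S] E(2)[of x] by auto
  ultimately show ?thesis using that Wscale by (auto simp: bounded_operator_def)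
qed

section \<open>Linear algebra of Riesz sequences\<close>

lemma riesz_coeff_zero:
  assumes "riesz_with_lower_bound smul u A" "finite F" "(\<Sum>n\<in>F. smul (c n) (u n)) = 0" "n \<in> F"
  shows "c n = 0"
proof -
  have A: "A > 0" and "A * (\<Sum>n\<in>F. (norm (c n))\<^sup>2) \<le> (norm (\<Sum>n\<in>F. smul (c n) (u n)))\<^sup>2"
    using assms(1,2) unfolding riesz_with_lower_bound_def by blast+
  hence "(\<Sum>n\<in>F. (norm (c n))\<^sup>2) \<le> 0" by (simp add: assms(3) mult_le_0_iff)
  hence "(\<Sum>n\<in>F. (norm (c n))\<^sup>2) = 0" by (intro antisym sum_nonneg) auto
  thus ?thesis using assms(2,4) by (simp add: sum_nonneg_eq_0_iff)
qed

text \<open>Two equal entries would cancel with coefficients 1 and -1. Injectivity lets the set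
  \<open>range u\<close> stand for the family \<open>u\<close>, since \<open>independent\<close> and
  \<open>span\<close> speak of sets.\<close>

lemma riesz_inj:
  assumes "riesz_with_lower_bound smul u A"
  shows "inj u"
proof (rule injI, rule ccontr)
  fix x y assume xy: "u x = u y" "x \<noteq> y"
  have "(\<Sum>n\<in>{x, y}. smul (if n = x then 1 else -1) (u n)) = 0" using xy by simp
  from riesz_coeff_zero[OF assms _ this, of x] show False by simp
qed

lemma riesz_independent:
  assumes "riesz_with_lower_bound smul u A"
  shows "independent (range u)"
proof
  assume "dependent (range u)"
  then obtain t c v where t: "finite t" "t \<subseteq> range u" "(\<Sum>v\<in>t. smul (c v) v) = 0" "v \<in> t" "c v \<noteq> 0"
    unfolding dependent_explicit by blast
  then obtain F where F: "finite F" "t = u ` F" by (meson finite_subset_image)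
  have "(\<Sum>n\<in>F. smul (c (u n)) (u n)) = 0"
    using t(3) unfolding F(2)
    by (subst (asm) sum.reindex) (auto intro: inj_on_subset[OF riesz_inj[OF assms]])
  with riesz_coeff_zero[OF assms F(1), of "\<lambda>n. c (u n)"] t F show False by auto
qed

text \<open>Turns combinations over sets of vectors into combinations over integer indices, the form
  in which the Riesz bounds are stated.\<close>

lemma span_range_explicit:
  assumes "inj u" "x \<in> span (range u)"
  obtains F c where "finite F" "x = (\<Sum>n\<in>F. smul (c n) (u n))"
proof -
  obtain t c where t: "finite t" "t \<subseteq> range u" "x = (\<Sum>v\<in>t. smul (c v) v)"
    using assms(2) unfolding span_explicit by blast
  then obtain F where F: "finite F" "t = u ` F" by (meson finite_subset_image)
  have "x = (\<Sum>n\<in>F. smul (c (u n)) (u n))"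
    unfolding t(3) F(2) by (subst sum.reindex) (auto intro: inj_on_subset[OF assms(1)])
  thus ?thesis by (rule that[OF F(1)])
qed

text \<open>Independence allows arbitrary values on \<open>range u\<close>. The map obtained is
  purely algebraic; bounds on the span have to be proved separately.\<close>

lemma riesz_linear_extension:
  assumes "riesz_with_lower_bound smul u A"
  shows "\<exists>G. module_hom smul smul G \<and> (\<forall>n. G (u n) = v n)"
proof -
  interpret pair: vector_space_pair smul smul ..
  obtain G where G: "Vector_Spaces.linear smul smul G" "\<forall>x\<in>range u. G x = v (inv u x)"
    using pair.linear_independent_extend[OF riesz_independent[OF assms], of "\<lambda>x. v (inv u x)"]
    by auto
  have "module_hom smul smul G" using G(1) by (simp add: linear_iff_module_hom)
  moreover have "G (u n) = v n" for n using G(2) riesz_inj[OF assms] by simp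
  ultimately show ?thesis by blast
qed

section \<open>The shift along a Riesz sequence\<close>

text \<open>Shifting moves coefficients to new positions without changing the sum of their squares,
  so the two Riesz bounds give norm at most \<open>sqrt (B / A)\<close> on the span. The backward
  shift is the inverse there.\<close>

lemma riesz_shift_operator:
  assumes u: "riesz_with_lower_bound smul u A"
  obtains W where "bounded_operator smul W" "operator_orbit smul W (u 0) u"
proof -
  define S where "S = span (range u)"
  obtain B where B: "B > 0" and AB: "\<And>F c. finite F \<Longrightarrow>
        A * (\<Sum>n\<in>F. (norm (c n))\<^sup>2) \<le> (norm (\<Sum>n\<in>F. smul (c n) (u n)))\<^sup>2 \<and>
        (norm (\<Sum>n\<in>F. smul (c n) (u n)))\<^sup>2 \<le> B * (\<Sum>n\<in>F. (norm (c n))\<^sup>2)" and A: "A > 0"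
    using u unfolding riesz_with_lower_bound_def by blast
  obtain G where G: "module_hom smul smul G" "\<And>n. G (u n) = u (n + 1)"
    using riesz_linear_extension[OF u, of "\<lambda>n. u (n + 1)"] by blast
  obtain G' where G': "module_hom smul smul G'" "\<And>n. G' (u n) = u (n - 1)"
    using riesz_linear_extension[OF u, of "\<lambda>n. u (n - 1)"] by blast
  interpret G: module_hom smul smul G by (rule G(1))
  interpret G': module_hom smul smul G' by (rule G'(1))
  have GS: "G x \<in> S" if "x \<in> S" for x
    using that unfolding S_def
    by (induction rule: span_induct_alt)
      (auto simp: G.add G.scale G(2) span_base span_zero span_add span_scale)
  have G'S: "G' x \<in> S" if "x \<in> S" for x
    using that unfolding S_def
    by (induction rule: span_induct_alt)
      (auto simp: G'.add G'.scale G'(2) span_base span_zero span_add span_scale)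
  \<comment> \<open>Both composites are linear and fix every \<open>u n\<close>, hence fix the span
    pointwise.\<close>
  have G'G: "G' (G x) = x" if "x \<in> S" for x
    using that unfolding S_def
    by (induction rule: span_induct_alt)
      (auto simp: G.add G.scale G(2) G'.add G'.scale G'(2))
  have GG': "G (G' x) = x" if "x \<in> S" for x
    using that unfolding S_def
    by (induction rule: span_induct_alt)
      (auto simp: G.add G.scale G(2) G'.add G'.scale G'(2))
  have bound: "norm (G x) \<le> sqrt (B / A) * norm x" if "x \<in> S" for x
  proof -
    have "x \<in> span (range u)" using that by (simp add: S_def)
    from span_range_explicit[OF riesz_inj[OF u] this]
    obtain F c where F: "finite F" "x = (\<Sum>n\<in>F. smul (c n) (u n))" by blast
    \<comment> \<open>\<open>F'\<close> carries the coefficients of \<open>F\<close> moved by one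
      place: the upper bound on \<open>F'\<close> controls \<open>G x\<close>, the lower bound on
      \<open>F\<close> controls the coefficients by \<open>x\<close>.\<close>
    define F' where "F' = (\<lambda>n. n + 1) ` F"
    have "G x = (\<Sum>n\<in>F. smul (c n) (u (n + 1)))"
      by (simp add: F(2) G.sum G.scale G(2))
    also have "\<dots> = (\<Sum>n\<in>F'. smul (c (n - 1)) (u n))"
      unfolding F'_def by (subst sum.reindex) auto
    finally have "(norm (G x))\<^sup>2 \<le> B * (\<Sum>n\<in>F'. (norm (c (n - 1)))\<^sup>2)"
      using AB[of F' "\<lambda>n. c (n - 1)"] F(1) by (simp add: F'_def)
    also have "(\<Sum>n\<in>F'. (norm (c (n - 1)))\<^sup>2) = (\<Sum>n\<in>F. (norm (c n))\<^sup>2)"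
      unfolding F'_def by (subst sum.reindex) auto
    also have "B * \<dots> \<le> B * ((norm x)\<^sup>2 / A)"
      using AB[OF F(1), of c] A B by (intro mult_left_mono) (auto simp: F(2) field_simps)
    finally have "(norm (G x))\<^sup>2 \<le> (B / A) * (norm x)\<^sup>2" by simp
    hence "sqrt ((norm (G x))\<^sup>2) \<le> sqrt ((B / A) * (norm x)\<^sup>2)" by (rule real_sqrt_le_mono)
    thus ?thesis by (simp only: real_sqrt_mult real_sqrt_abs abs_norm_cancel)
  qed
  obtain W where W: "bounded_operator smul W" "\<And>x. x \<in> S \<Longrightarrow> W x = G x"
    by (rule bounded_operator_extension[of S G "sqrt (B / A)"])
      (auto simp: S_def G.add G.scale bound[unfolded S_def])
  have uS: "u n \<in> S" for n by (simp add: S_def span_base)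
  have Wu: "W (u n) = u (n + 1)" for n by (simp add: W(2) uS G(2))
  have bij: "bij_betw W S S"
    by (rule bij_betw_byWitness[where f' = G']) (auto simp: W(2) G'G GG' GS G'S)
  \<comment> \<open>\<open>W\<close> sends \<open>u (n - 1)\<close> to \<open>u n\<close>, and
    injectivity on \<open>S\<close> identifies the preimage; iteration from \<open>u 0\<close> gives
    the negative powers.\<close>
  have inv: "the_inv_into S W (u n) = u (n - 1)" for n
    using the_inv_into_f_f[OF bij_betw_imp_inj_on[OF bij] uS[of "n - 1"]] Wu[of "n - 1"] by simp
  have pos: "(W ^^ k) (u 0) = u (int k)" for k
    by (induction k) (auto simp: Wu add.commute)
  have neg: "(the_inv_into S W ^^ k) (u 0) = u (- int k)" for k
    by (induction k) (auto simp: inv intro: arg_cong[where f = u])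
  have "operator_orbit smul W (u 0) u"
    unfolding operator_orbit_def Let_def S_def[symmetric] using bij by (simp add: pos neg)
  with W(1) that show ?thesis by blast
qed

section \<open>Stability of Riesz sequences under perturbation\<close>

text \<open>With \<open>s\<close> the square root of the sum of squared coefficients, the two
  combinations differ by at most \<open>\<mu> * s\<close> in norm, so the triangle inequality turns
  \<open>sqrt A\<close> into \<open>sqrt A - \<mu>\<close> and \<open>sqrt B\<close> into
  \<open>sqrt B + \<mu>\<close>.\<close>

lemma riesz_perturbation:
  assumes h: "riesz_with_lower_bound smul h A" and \<mu>: "\<mu> < sqrt A"
    and pert: "\<And>F c. finite F \<Longrightarrow>
      norm (\<Sum>n\<in>F. smul (c n) (h n - u n)) \<le> \<mu> * sqrt (\<Sum>n\<in>F. (norm (c n))\<^sup>2)"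
  shows "riesz_with_lower_bound smul u ((sqrt A - \<mu>)\<^sup>2)"
proof -
  obtain B where B: "B > 0" and AB: "\<And>F c. finite F \<Longrightarrow>
        A * (\<Sum>n\<in>F. (norm (c n))\<^sup>2) \<le> (norm (\<Sum>n\<in>F. smul (c n) (h n)))\<^sup>2 \<and>
        (norm (\<Sum>n\<in>F. smul (c n) (h n)))\<^sup>2 \<le> B * (\<Sum>n\<in>F. (norm (c n))\<^sup>2)" and A: "A > 0"
    using h unfolding riesz_with_lower_bound_def by blast
  \<comment> \<open>A single coefficient 1 shows that \<mu> is nonnegative, which keeps the new
    upper constant positive.\<close>
  have "0 \<le> norm (\<Sum>n\<in>{0}. smul 1 (h n - u n))" by simp
  also have "\<dots> \<le> \<mu>" using pert[of "{0}" "\<lambda>_. 1"] by simp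
  finally have \<mu>0: "\<mu> \<ge> 0" .
  have "(sqrt A - \<mu>)\<^sup>2 * (\<Sum>n\<in>F. (norm (c n))\<^sup>2) \<le> (norm (\<Sum>n\<in>F. smul (c n) (u n)))\<^sup>2 \<and>
        (norm (\<Sum>n\<in>F. smul (c n) (u n)))\<^sup>2 \<le> (sqrt B + \<mu>)\<^sup>2 * (\<Sum>n\<in>F. (norm (c n))\<^sup>2)"
    if F: "finite F" for F and c :: "int \<Rightarrow> 'k"
  proof -
    define s where "s = sqrt (\<Sum>n\<in>F. (norm (c n))\<^sup>2)"
    have s: "s \<ge> 0" "(\<Sum>n\<in>F. (norm (c n))\<^sup>2) = s\<^sup>2" by (simp_all add: s_def sum_nonneg)
    define x where "x = (\<Sum>n\<in>F. smul (c n) (h n))"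
    define y where "y = (\<Sum>n\<in>F. smul (c n) (u n))"
    have xy: "norm (x - y) \<le> \<mu> * s"
      using pert[OF F, of c] by (simp add: x_def y_def s_def scale_right_diff_distrib sum_subtractf)
    have "(sqrt A * s)\<^sup>2 \<le> (norm x)\<^sup>2" "(norm x)\<^sup>2 \<le> (sqrt B * s)\<^sup>2"
      using AB[OF F, of c] A B s(2) by (simp_all add: x_def power_mult_distrib)
    hence "sqrt A * s \<le> norm x" "norm x \<le> sqrt B * s"
      using B s(1) by (auto intro: power2_le_imp_le)
    hence "(sqrt A - \<mu>) * s \<le> norm y" "norm y \<le> (sqrt B + \<mu>) * s"
      using xy norm_triangle_ineq2[of x y] norm_triangle_ineq2[of y x]
      by (auto simp: algebra_simps norm_minus_commute)
    \<comment> \<open>Squaring preserves the lower estimate because \<mu> < \<open>sqrt A\<close>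
      makes its left side nonnegative.\<close>
    hence "((sqrt A - \<mu>) * s)\<^sup>2 \<le> (norm y)\<^sup>2" "(norm y)\<^sup>2 \<le> ((sqrt B + \<mu>) * s)\<^sup>2"
      using \<mu> s(1) by (auto intro!: power_mono)
    thus ?thesis by (simp add: y_def s(2) power_mult_distrib)
  qed
  moreover have "(sqrt A - \<mu>)\<^sup>2 > 0" "(sqrt B + \<mu>)\<^sup>2 > 0"
    using \<mu> add_pos_nonneg[of "sqrt B" \<mu>] \<mu>0 B by auto
  ultimately show ?thesis unfolding riesz_with_lower_bound_def by blast
qed

end

theorem theorem4p4:
  fixes smul :: "'k::hilbert_scalar \<Rightarrow> 'h::banach \<Rightarrow> 'h"
    and ip :: "'h \<Rightarrow> 'h \<Rightarrow> 'k"
    and f g :: "int \<Rightarrow> 'h"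
    and J :: nat
    and T :: "nat \<Rightarrow> 'h \<Rightarrow> 'h"
    and \<phi> :: "nat \<Rightarrow> 'h"
    and h :: "nat \<Rightarrow> int \<Rightarrow> 'h"
    and A \<mu> :: real
  assumes "hilbert_space smul ip"
    and "is_frame ip f"
    and "norm_bounded_below f"
    and "\<forall>j\<in>{1..J}. \<phi> j \<in> range f"
    and "\<forall>j\<in>{1..J}. bounded_operator smul (T j)"
    and "\<forall>j\<in>{1..J}. operator_orbit smul (T j) (\<phi> j) (h j)"
    and "\<forall>j\<in>{1..J}. riesz_sequence smul (h j)"
    and "indexed_union J h f"
    and "frame_with_lower_bound ip f A"
    and "\<forall>j\<in>{1..J}. riesz_with_lower_bound smul (h j) A"
    and "\<mu> < sqrt A"
    and "\<forall>F c. finite F \<longrightarrow>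
           norm (\<Sum>k\<in>F. smul (c k) (f k - g k)) \<le> \<mu> * sqrt (\<Sum>k\<in>F. (norm (c k))\<^sup>2)"
  shows "\<exists>(\<psi> :: nat \<Rightarrow> 'h) (W :: nat \<Rightarrow> 'h \<Rightarrow> 'h) (u :: nat \<Rightarrow> int \<Rightarrow> 'h).
           (\<forall>j\<in>{1..J}. \<psi> j \<in> range g) \<and>
           (\<forall>j\<in>{1..J}. bounded_operator smul (W j)) \<and>
           (\<forall>j\<in>{1..J}. operator_orbit smul (W j) (\<psi> j) (u j)) \<and>
           (\<forall>j\<in>{1..J}. riesz_sequence smul (u j)) \<and>
           indexed_union J u g"
proof -
  interpret hilbert_space smul ip by (rule assms(1))
  obtain I e where I: "disjoint_family_on I {1..J}" "(\<Union>j\<in>{1..J}. I j) = UNIV"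
    and e: "\<And>j. j \<in> {1..J} \<Longrightarrow> bij_betw (e j) UNIV (I j)"
    and h: "\<And>j n. j \<in> {1..J} \<Longrightarrow> h j n = f (e j n)"
    using assms(8) unfolding indexed_union_def by blast
  \<comment> \<open>The partition and enumerations of \<open>f\<close> are reused, so
    \<open>u j\<close> is the part of \<open>g\<close> over the same indices as
    \<open>h j\<close>.\<close>
  define u where "u = (\<lambda>j n. g (e j n))"
  have riesz: "riesz_with_lower_bound smul (u j) ((sqrt A - \<mu>)\<^sup>2)" if j: "j \<in> {1..J}" for j
  proof (rule riesz_perturbation)
    show "riesz_with_lower_bound smul (h j) A" "\<mu> < sqrt A" using assms(10,11) j by auto
    fix F :: "int set" and c :: "int \<Rightarrow> 'k" assume F: "finite F"
    have inj: "inj (e j)" using e[OF j] by (simp add: bij_betw_def)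
    hence injF: "inj_on (e j) F" by (rule inj_on_subset) simp
    \<comment> \<open>Coefficients on the orbit indices are carried to the global indices by the
      inverse of \<open>e j\<close>, where the perturbation hypothesis applies.\<close>
    have "norm (\<Sum>k\<in>e j ` F. smul (c (inv (e j) k)) (f k - g k))
        \<le> \<mu> * sqrt (\<Sum>k\<in>e j ` F. (norm (c (inv (e j) k)))\<^sup>2)"
      by (rule assms(12)[rule_format]) (use F in simp)
    thus "norm (\<Sum>n\<in>F. smul (c n) (h j n - u j n)) \<le> \<mu> * sqrt (\<Sum>n\<in>F. (norm (c n))\<^sup>2)"
      by (simp add: sum.reindex[OF injF] inv_f_f[OF inj] h[OF j] u_def)
  qed
  have "\<forall>j\<in>{1..J}. \<exists>W. bounded_operator smul W \<and> operator_orbit smul W (u j 0) (u j)"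
    by (meson riesz riesz_shift_operator)
  then obtain W where
    "\<forall>j\<in>{1..J}. bounded_operator smul (W j) \<and> operator_orbit smul (W j) (u j 0) (u j)"
    by metis
  moreover have "\<forall>j\<in>{1..J}. riesz_sequence smul (u j)"
    using riesz unfolding riesz_sequence_def by blast
  moreover have "indexed_union J u g"
    unfolding indexed_union_def u_def using I e by blast
  moreover have "\<forall>j\<in>{1..J}. u j 0 \<in> range g" by (simp add: u_def)
  ultimately show ?thesis
    \<comment> \<open>Each generator is the entry of its orbit at index 0, as
      \<open>operator_orbit\<close> requires.\<close>
    by (intro exI[of _ "\<lambda>j. u j 0"] exI[of _ W] exI[of _ u]) auto
qed

end
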